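(* Let $(Q,\diamond)$ be a rack and let $\mathcal{A}:Q\rightarrow Q$ be an averaging operator on $Q$. Then $(Q,\diamond_{\mathcal{A}})$ is a rack (called the descendent rack), where $x\diamond_{\mathcal{A}}y := \mathcal{A}(x)\diamond y$ for $x,y\in Q$. Then $\mathcal{A}:Q\rightarrow Q$ is a morphism of racks from the descendent rack $(Q,\diamond_{\mathcal{A}})$ to the rack $(Q,\diamond)$. Moreover, $\mathcal{A}:Q\rightarrow Q$ is an averaging operator on the descendent rack $(Q,\diamond_{\mathcal{A}})$.
   Context: A (left) rack $(Q,\diamond)$ is a nonempty set $Q$ with a binary operation $\diamond$ such that $x\diamond(y\diamond z) = (x\diamond y)\diamond(x\diamond z)$ for all $x,y,z\in Q$, and for any $x,y\in Q$ there is a unique $c\in Q$ with $x\diamond c = y$. A morphism of racks is a map preserving the rack operations. An averaging operator on a rack $(Q,\diamond)$ is a map $\mathcal{A}:Q\to Q$ satisfying $\mathcal{A}(x)\diamond\mathcal{A}(y) = \mathcal{A}(\mathcal{A}(x)\diamond y)$ for all $x,y\in Q$. *)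

theory Defs
  imports Main "HOL-Library.FuncSet"
begin

locale rack =
  fixes Q :: "'a set" and rop :: "'a \<Rightarrow> 'a \<Rightarrow> 'a" (infixr "\<diamond>" 70)
  assumes nonempty: "Q \<noteq> {}"
    and closed: "\<lbrakk>x \<in> Q; y \<in> Q\<rbrakk> \<Longrightarrow> x \<diamond> y \<in> Q"
    and left_distrib: "\<lbrakk>x \<in> Q; y \<in> Q; z \<in> Q\<rbrakk> \<Longrightarrow> x \<diamond> (y \<diamond> z) = (x \<diamond> y) \<diamond> (x \<diamond> z)"
    and unique_left_solution: "\<lbrakk>x \<in> Q; y \<in> Q\<rbrakk> \<Longrightarrow> \<exists>!c. c \<in> Q \<and> x \<diamond> c = y"

locale rack_morphism =
  source: rack Q rop + target: rack Q' rop'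
  for Q :: "'a set" and rop :: "'a \<Rightarrow> 'a \<Rightarrow> 'a"
    and Q' :: "'b set" and rop' :: "'b \<Rightarrow> 'b \<Rightarrow> 'b" +
  fixes f :: "'a \<Rightarrow> 'b"
  assumes maps_to: "f \<in> Q \<rightarrow> Q'"
    and preserves: "\<lbrakk>x \<in> Q; y \<in> Q\<rbrakk> \<Longrightarrow> f (rop x y) = rop' (f x) (f y)"

locale averaging_operator = rack Q rop
  for Q :: "'a set" and rop :: "'a \<Rightarrow> 'a \<Rightarrow> 'a" (infixr "\<diamond>" 70) +
  fixes A :: "'a \<Rightarrow> 'a"
  assumes maps_to: "A \<in> Q \<rightarrow> Q"
    and averaging: "\<lbrakk>x \<in> Q; y \<in> Q\<rbrakk> \<Longrightarrow> A x \<diamond> A y = A (A x \<diamond> y)"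

definition descendent_op :: "('a \<Rightarrow> 'a \<Rightarrow> 'a) \<Rightarrow> ('a \<Rightarrow> 'a) \<Rightarrow> 'a \<Rightarrow> 'a \<Rightarrow> 'a" where
  "descendent_op rop A x y = rop (A x) y"

end

theory Submission
  imports Defs
begin

text \<open>In the descendent operation, left translation by \<open>x\<close> is the original left
  translation by \<open>A x\<close>. Since \<open>A\<close> maps \<open>Q\<close> into itself,
  closure and unique solvability are inherited. Self-distributivity, the morphism law and the new
  averaging law all come from the one averaging identity, which says that \<open>A\<close> sends the
  descendent product of \<open>x\<close> and \<open>y\<close> to
  \<open>A x \<diamond> A y\<close>.\<close>

context averaging_operator
begin

lemma A_closed: "x \<in> Q \<Longrightarrow> A x \<in> Q"
  using maps_to by blast

lemma rack_descendent: "rack Q (descendent_op rop A)"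
proof
  show "Q \<noteq> {}"
    by (rule nonempty)
  fix x y assume xy: "x \<in> Q" "y \<in> Q"
  show "descendent_op rop A x y \<in> Q"
    using xy by (simp add: descendent_op_def A_closed closed)
  show "\<exists>!c. c \<in> Q \<and> descendent_op rop A x c = y"
    using unique_left_solution[OF A_closed[OF xy(1)] xy(2)] by (simp add: descendent_op_def)
  fix z assume z: "z \<in> Q"
  have "A x \<diamond> (A y \<diamond> z) = (A x \<diamond> A y) \<diamond> (A x \<diamond> z)"
    using xy z by (simp add: left_distrib A_closed)
  \<comment> \<open>The left factor must be \<open>A\<close> of the descendent product of
    \<open>x\<close> and \<open>y\<close> for the outer product to be a descendent one.\<close>
  also have "\<dots> = A (A x \<diamond> y) \<diamond> (A x \<diamond> z)"
    using xy by (simp add: averaging)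
  finally show "descendent_op rop A x (descendent_op rop A y z)
      = descendent_op rop A (descendent_op rop A x y) (descendent_op rop A x z)"
    by (simp add: descendent_op_def)
qed

lemma rack_morphism_descendent: "rack_morphism Q (descendent_op rop A) Q rop A"
  by (intro rack_morphism.intro rack_morphism_axioms.intro rack_descendent rack_axioms maps_to)
    (simp add: descendent_op_def averaging)

text \<open>Once unfolded, the new averaging law is the old one at the pair \<open>A x\<close>,
  \<open>y\<close>, which is why \<open>A_closed\<close> is needed.\<close>

lemma averaging_operator_descendent: "averaging_operator Q (descendent_op rop A) A"
  by (intro averaging_operator.intro averaging_operator_axioms.intro rack_descendent maps_to)
    (simp add: descendent_op_def averaging A_closed)

end

theorem proposition3p8:
  fixes Q :: "'a set" and rop :: "'a \<Rightarrow> 'a \<Rightarrow> 'a" and A :: "'a \<Rightarrow> 'a"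
  assumes "rack Q rop"
    and "averaging_operator Q rop A"
  shows "rack Q (descendent_op rop A)
       \<and> rack_morphism Q (descendent_op rop A) Q rop A
       \<and> averaging_operator Q (descendent_op rop A) A"
  using averaging_operator.rack_descendent[OF assms(2)]
    averaging_operator.rack_morphism_descendent[OF assms(2)]
    averaging_operator.averaging_operator_descendent[OF assms(2)]
  by blast

end
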